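(* Let $M\subset\mathbb{R}^n$ be a weak $r$-helix submanifold with respect to the directions $d_1,\dots,d_r\in\mathbb{R}^n$. Let $j\in\{1,\dots,r\}$, let $T_j$ be the unit tangent component and $\xi_j$ the unit normal component of $d_j$ along $M$. If $\alpha_j:I\subset\mathbb{R}\to M$ is a (unit speed) integral curve of $T_j$, then $\alpha_j$ is asymptotic in the direction $\xi_j$, i.e. $\langle A^{\xi_j}(T_j),T_j\rangle=0$ along $\alpha_j$.
   Context: All submanifolds, curves and vector fields are smooth; $\mathbb{R}^n$ has its Euclidean metric, with standard covariant derivative $D$. A submanifold $M\subset\mathbb{R}^n$ is a helix with respect to a unit vector $d\in\mathbb{R}^n$ if the angle $\theta$ between $d$ and $T_qM$ is the same for all $q\in M$; it is assumed that $0<\theta<\pi/2$. Then along $M$ one has $d=\cos(\theta)\,T+\sin(\theta)\,\xi$ with $T$ a unit tangent vector field of $M$ (the unit tangent component of $d$) and $\xi$ a unit normal vector field of $M$ (the normal component of $d$). $M$ is a weak $r$-helix with respect to $d_1,\dots,d_r$ if these are $r$ linearly independent unit vectors and $M$ is a helix with respect to every $d_j$; write $d_j=\cos(\theta_j)T_j+\sin(\theta_j)\xi_j$. For a normal field $\xi$ and a tangent vector $X$ of $M$, the shape operator $A^{\xi}(X)$ is the tangential component of $-D_X\xi$. A unit speed curve $\alpha$ in $M$ with unit tangent $T$ is called asymptotic in the direction of a normal field $\xi$ if $\langle A^{\xi}(T),T\rangle=0$ along $\alpha$. *)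

theory Defs
  imports "HOL-Analysis.Analysis"
begin

(* The derivative is taken within S so that curves on intervals containing an endpoint are covered.
   It is determined by f when S is open or a nondegenerate interval, the only cases used below. *)
primrec Ck_on :: "nat \<Rightarrow> 'a::real_normed_vector set \<Rightarrow> ('a \<Rightarrow> 'b::real_normed_vector) \<Rightarrow> bool" where
  "Ck_on 0 S f \<longleftrightarrow> continuous_on S f"
| "Ck_on (Suc k) S f \<longleftrightarrow>
     f differentiable_on S \<and> (\<forall>v. Ck_on k S (\<lambda>x. frechet_derivative f (at x within S) v))"

definition smooth_on :: "'a::real_normed_vector set \<Rightarrow> ('a \<Rightarrow> 'b::real_normed_vector) \<Rightarrow> bool" where
  "smooth_on S f \<longleftrightarrow> (\<forall>k. Ck_on k S f)"

definition diffeomorphism ::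
  "'a::euclidean_space set \<Rightarrow> 'a set \<Rightarrow> ('a \<Rightarrow> 'a) \<Rightarrow> ('a \<Rightarrow> 'a) \<Rightarrow> bool" where
  "diffeomorphism U V \<phi> \<psi> \<longleftrightarrow>
     open U \<and> open V \<and> homeomorphism U V \<phi> \<psi> \<and> smooth_on U \<phi> \<and> smooth_on V \<psi>"

(* Embedded submanifolds without boundary, of one dimension m, given by slice charts. *)
definition submanifold :: "'a::euclidean_space set \<Rightarrow> bool" where
  "submanifold M \<longleftrightarrow>
     (\<exists>m. \<forall>p\<in>M. \<exists>U V \<phi> \<psi> S. diffeomorphism U V \<phi> \<psi> \<and> p \<in> U \<and>
        subspace S \<and> dim S = m \<and> \<phi> ` (M \<inter> U) = S \<inter> V)"

definition tangent_space :: "'a::euclidean_space set \<Rightarrow> 'a \<Rightarrow> 'a set" where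
  "tangent_space M q =
     {v. \<exists>\<epsilon>>0. \<exists>\<gamma>::real \<Rightarrow> 'a. smooth_on {-\<epsilon><..<\<epsilon>} \<gamma> \<and> \<gamma> ` {-\<epsilon><..<\<epsilon>} \<subseteq> M \<and>
        \<gamma> 0 = q \<and> (\<gamma> has_vector_derivative v) (at 0)}"

definition tangent_part :: "'a::euclidean_space set \<Rightarrow> 'a \<Rightarrow> 'a \<Rightarrow> 'a" where
  "tangent_part M q v =
     (THE u. u \<in> tangent_space M q \<and> v - u \<in> orthogonal_comp (tangent_space M q))"

definition normal_part :: "'a::euclidean_space set \<Rightarrow> 'a \<Rightarrow> 'a \<Rightarrow> 'a" where
  "normal_part M q v = v - tangent_part M q v"

definition angle :: "'a::euclidean_space \<Rightarrow> 'a \<Rightarrow> real" where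
  "angle v w = arccos (v \<bullet> w / (norm v * norm w))"

(* The angle between a vector and a subspace is its angle with the orthogonal projection;
   it is pi/2 if the projection vanishes, since then the quotient in angle is 0/0 = 0. *)
definition angle_tangent_space :: "'a::euclidean_space set \<Rightarrow> 'a \<Rightarrow> 'a \<Rightarrow> real" where
  "angle_tangent_space M q d = angle d (tangent_part M q d)"

definition helix :: "'a::euclidean_space set \<Rightarrow> 'a \<Rightarrow> bool" where
  "helix M d \<longleftrightarrow>
     submanifold M \<and> norm d = 1 \<and>
     (\<exists>\<theta>. 0 < \<theta> \<and> \<theta> < pi/2 \<and> (\<forall>q\<in>M. angle_tangent_space M q d = \<theta>))"

definition weak_helix :: "nat \<Rightarrow> 'a::euclidean_space set \<Rightarrow> (nat \<Rightarrow> 'a) \<Rightarrow> bool" where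
  "weak_helix r M d \<longleftrightarrow>
     submanifold M \<and> inj_on d {1..r} \<and> independent (d ` {1..r}) \<and> (\<forall>j\<in>{1..r}. helix M (d j))"

(* For a helix of angle \<theta>, the parts of d have norms cos \<theta> > 0 and sin \<theta> > 0, so these
   are the fields T and \<xi> in d = cos \<theta> T + sin \<theta> \<xi>. *)
definition unit_tangent_component :: "'a::euclidean_space set \<Rightarrow> 'a \<Rightarrow> 'a \<Rightarrow> 'a" where
  "unit_tangent_component M d q = sgn (tangent_part M q d)"

definition unit_normal_component :: "'a::euclidean_space set \<Rightarrow> 'a \<Rightarrow> 'a \<Rightarrow> 'a" where
  "unit_normal_component M d q = sgn (normal_part M q d)"

(* D_X \<xi> for a field \<xi> along M and X tangent to M at q. Derivatives of \<xi> within M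
   need not be unique as linear maps on the ambient space, but they agree on tangent vectors of M,
   being there the derivatives of \<xi> along curves in M. *)
definition covariant_derivative ::
  "'a::euclidean_space set \<Rightarrow> ('a \<Rightarrow> 'a) \<Rightarrow> 'a \<Rightarrow> 'a \<Rightarrow> 'a" where
  "covariant_derivative M \<xi> q X = frechet_derivative \<xi> (at q within M) X"

definition shape_operator ::
  "'a::euclidean_space set \<Rightarrow> ('a \<Rightarrow> 'a) \<Rightarrow> 'a \<Rightarrow> 'a \<Rightarrow> 'a" where
  "shape_operator M \<xi> q X = tangent_part M q (- covariant_derivative M \<xi> q X)"

definition curve_in :: "'a::euclidean_space set \<Rightarrow> real set \<Rightarrow> (real \<Rightarrow> 'a) \<Rightarrow> bool" where
  "curve_in M I \<alpha> \<longleftrightarrow>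
     is_interval I \<and> interior I \<noteq> {} \<and> smooth_on I \<alpha> \<and> \<alpha> ` I \<subseteq> M"

definition velocity :: "real set \<Rightarrow> (real \<Rightarrow> 'a::euclidean_space) \<Rightarrow> real \<Rightarrow> 'a" where
  "velocity I \<alpha> t = vector_derivative \<alpha> (at t within I)"

definition unit_speed_curve_in ::
  "'a::euclidean_space set \<Rightarrow> real set \<Rightarrow> (real \<Rightarrow> 'a) \<Rightarrow> bool" where
  "unit_speed_curve_in M I \<alpha> \<longleftrightarrow> curve_in M I \<alpha> \<and> (\<forall>t\<in>I. norm (velocity I \<alpha> t) = 1)"

definition integral_curve ::
  "'a::euclidean_space set \<Rightarrow> ('a \<Rightarrow> 'a) \<Rightarrow> real set \<Rightarrow> (real \<Rightarrow> 'a) \<Rightarrow> bool" where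
  "integral_curve M X I \<alpha> \<longleftrightarrow>
     curve_in M I \<alpha> \<and> (\<forall>t\<in>I. (\<alpha> has_vector_derivative X (\<alpha> t)) (at t within I))"

definition asymptotic ::
  "'a::euclidean_space set \<Rightarrow> ('a \<Rightarrow> 'a) \<Rightarrow> real set \<Rightarrow> (real \<Rightarrow> 'a) \<Rightarrow> bool" where
  "asymptotic M \<xi> I \<alpha> \<longleftrightarrow>
     unit_speed_curve_in M I \<alpha> \<and>
     (\<forall>t\<in>I. shape_operator M \<xi> (\<alpha> t) (velocity I \<alpha> t) \<bullet> velocity I \<alpha> t = 0)"

end

theory Submission
  imports Defs
begin

text \<open>
  Write \<open>d = cos \<theta> T + sin \<theta> \<xi>\<close> on a helix. Both \<open>\<xi> \<bullet> d = sin \<theta>\<close> and \<open>\<xi> \<bullet> \<xi> = 1\<close> are constant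
  on \<open>M\<close>, and \<open>d\<close> is a constant vector. Differentiating along a curve with velocity \<open>X\<close> shows that
  \<open>D\<^sub>X \<xi>\<close> is orthogonal to \<open>d\<close> and to \<open>\<xi>\<close>, hence to \<open>T\<close>, because \<open>cos \<theta> \<noteq> 0\<close>. As \<open>T\<close> is
  tangent, passing to the tangential component does not change the inner product with \<open>T\<close>. So
  \<open>A\<^sup>\<xi>(X) \<bullet> T = 0\<close>, in particular for \<open>X = T\<close>.

  This argument presupposes two facts about submanifolds. Firstly, the set of velocities at a point
  is a linear subspace, so that the tangential part really is the orthogonal projection: a slice
  chart with inverse \<open>\<psi>\<close> identifies the velocities with the image of the slice under the derivative of
  \<open>\<psi>\<close> (lemma \<open>tangent_space_slice_chart\<close>). Secondly, \<open>\<xi>\<close> is differentiable within \<open>M\<close>; without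
  this, the derivative in the shape operator would be an arbitrary choice. The derivative of \<open>\<psi>\<close>
  maps a basis of the slice to differentiable fields that form a basis of every nearby tangent space,
  and Gram-Schmidt orthogonalization, which only uses inner products and division by
  functions without zeros, makes the projection onto their span differentiable (lemmas \<open>differentiable_projection_onto_span\<close> and
  \<open>differentiable_tangent_part\<close>).
\<close>

section \<open>Differentiability along affine lines\<close>

lemma frechet_derivative_within_cong:
  assumes "\<And>x. x \<in> S \<Longrightarrow> f x = g x" "x \<in> S"
  shows "frechet_derivative f (at x within S) = frechet_derivative g (at x within S)"
proof -
  have "(f has_derivative D) (at x within S) \<longleftrightarrow> (g has_derivative D) (at x within S)" for D
    using assms by (metis has_derivative_transform)
  then show ?thesis
    unfolding frechet_derivative_def by simp
qed

lemma Ck_on_cong: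
  assumes "\<And>x. x \<in> S \<Longrightarrow> f x = g x"
  shows "Ck_on k S f \<longleftrightarrow> Ck_on k S g"
  using assms
proof (induction k arbitrary: f g)
  case 0
  then show ?case by (simp cong: continuous_on_cong)
next
  case (Suc k)
  have "f differentiable_on S \<longleftrightarrow> g differentiable_on S"
    using Suc.prems unfolding differentiable_on_def differentiable_def
    by (metis has_derivative_transform)
  moreover have "Ck_on k S (\<lambda>x. frechet_derivative f (at x within S) v) \<longleftrightarrow>
      Ck_on k S (\<lambda>x. frechet_derivative g (at x within S) v)" for v
    by (rule Suc.IH) (simp add: frechet_derivative_within_cong[OF Suc.prems])
  ultimately show ?case by simp
qed

text \<open>
  A directional derivative along the line parameter is again a function of the same shape, namely a
  directional derivative of \<open>f\<close> composed with the line; so the induction runs over all \<open>f\<close>.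
\<close>

lemma Ck_on_affine_line:
  fixes a s :: "'a::real_normed_vector"
  assumes "Ck_on k V f" "open J" and sub: "\<And>t. t \<in> J \<Longrightarrow> a + t *\<^sub>R s \<in> V"
  shows "Ck_on k J (\<lambda>t. f (a + t *\<^sub>R s))"
  using assms(1)
proof (induction k arbitrary: f)
  case 0
  then show ?case
    using sub by (auto intro!: continuous_on_compose2[of V f] continuous_intros)
next
  case (Suc k)
  have chain: "((\<lambda>t. f (a + t *\<^sub>R s)) has_derivative
      (\<lambda>h. frechet_derivative f (at (a + t *\<^sub>R s) within V) (h *\<^sub>R s))) (at t within J)"
    if t: "t \<in> J" for t
  proof -
    have "(f has_derivative frechet_derivative f (at y within V)) (at y within V)" if "y \<in> V" for y
      using Suc.prems that by (simp add: differentiable_on_def frechet_derivative_works)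
    moreover have "((\<lambda>t. a + t *\<^sub>R s) has_derivative (\<lambda>h. h *\<^sub>R s)) (at t within J)"
      by (auto intro!: derivative_eq_intros)
    moreover have "(\<lambda>t. a + t *\<^sub>R s) ` J \<subseteq> V"
      using sub by blast
    ultimately show ?thesis
      using has_derivative_in_compose2[of V f "\<lambda>y. frechet_derivative f (at y within V)"] t by blast
  qed
  then have "(\<lambda>t. f (a + t *\<^sub>R s)) differentiable_on J"
    unfolding differentiable_on_def differentiable_def by blast
  moreover have "Ck_on k J (\<lambda>t. frechet_derivative (\<lambda>t. f (a + t *\<^sub>R s)) (at t within J) v)" for v
  proof -
    have "frechet_derivative (\<lambda>t. f (a + t *\<^sub>R s)) (at t within J) v =
        frechet_derivative f (at (a + t *\<^sub>R s) within V) (v *\<^sub>R s)" if t: "t \<in> J" for t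
    proof -
      note at_t = at_within_open[OF t \<open>open J\<close>]
      show ?thesis
        using fun_cong[OF frechet_derivative_at[OF chain[OF t, unfolded at_t]], of v] by (simp add: at_t)
    qed
    moreover have "Ck_on k J (\<lambda>t. frechet_derivative f (at (a + t *\<^sub>R s) within V) (v *\<^sub>R s))"
      using Suc.prems by (intro Suc.IH) simp
    ultimately show ?thesis
      by (rule Ck_on_cong[THEN iffD2])
  qed
  ultimately show ?case by simp
qed

section \<open>Tangent spaces in slice charts\<close>

lemma smooth_on_has_derivative:
  assumes "smooth_on U f" "x \<in> U"
  shows "(f has_derivative frechet_derivative f (at x within U)) (at x within U)"
proof -
  have "Ck_on (Suc 0) U f"
    using assms(1) unfolding smooth_on_def by blast
  then show ?thesis
    using assms(2) by (simp add: differentiable_on_def frechet_derivative_works)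
qed

lemma smooth_on_differentiable_derivative:
  assumes "smooth_on U f"
  shows "(\<lambda>x. frechet_derivative f (at x within U) v) differentiable_on U"
proof -
  have "Ck_on (Suc (Suc 0)) U f"
    using assms unfolding smooth_on_def by blast
  then show ?thesis by simp
qed

lemma diffeomorphism_sym: "diffeomorphism U V \<phi> \<psi> \<Longrightarrow> diffeomorphism V U \<psi> \<phi>"
  unfolding diffeomorphism_def by (auto intro: homeomorphism_symD)

lemma diffeomorphism_inverse:
  assumes "diffeomorphism U V \<phi> \<psi>" "x \<in> U"
  shows "\<phi> x \<in> V" "\<psi> (\<phi> x) = x"
  using assms unfolding diffeomorphism_def homeomorphism_def by auto

lemma diffeomorphism_derivative_inverse:
  assumes diffeo: "diffeomorphism U V \<phi> \<psi>" and x: "x \<in> U"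
  shows "frechet_derivative \<psi> (at (\<phi> x) within V) (frechet_derivative \<phi> (at x within U) v) = v"
proof -
  have "open U"
    using diffeo by (simp add: diffeomorphism_def)
  have "((\<lambda>y. \<psi> (\<phi> y)) has_derivative (\<lambda>h. frechet_derivative \<psi> (at (\<phi> x) within V)
      (frechet_derivative \<phi> (at x within U) h))) (at x within U)"
  proof (rule has_derivative_in_compose2[where g = \<psi> and t = V
        and g' = "\<lambda>y. frechet_derivative \<psi> (at y within V)"])
    show "(\<psi> has_derivative frechet_derivative \<psi> (at y within V)) (at y within V)" if "y \<in> V" for y
      using diffeo that smooth_on_has_derivative by (auto simp: diffeomorphism_def)
    show "(\<phi> has_derivative frechet_derivative \<phi> (at x within U)) (at x within U)"
      using diffeo x smooth_on_has_derivative by (auto simp: diffeomorphism_def)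
  qed (use x diffeomorphism_inverse[OF diffeo] in auto)
  then have "((\<lambda>y. y) has_derivative (\<lambda>h. frechet_derivative \<psi> (at (\<phi> x) within V)
      (frechet_derivative \<phi> (at x within U) h))) (at x within U)"
    by (rule has_derivative_transform[OF x, rotated]) (simp add: diffeomorphism_inverse(2)[OF diffeo])
  then have "(\<lambda>h. frechet_derivative \<psi> (at (\<phi> x) within V)
      (frechet_derivative \<phi> (at x within U) h)) = (\<lambda>h. h)"
    using x \<open>open U\<close> by (metis at_within_open has_derivative_ident has_derivative_unique)
  then show ?thesis by metis
qed

text \<open>
  A line in the slice is carried by \<open>\<psi>\<close> to a curve in \<open>M\<close>, which gives one inclusion. Conversely
  \<open>\<phi>\<close> carries a curve in \<open>M\<close> to a curve in the slice, whose velocity stays in the slice because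
  every linear functional that vanishes on the slice vanishes on the velocity.
\<close>

lemma tangent_space_slice_chart:
  fixes M :: "'a::euclidean_space set"
  assumes diffeo: "diffeomorphism U V \<phi> \<psi>" and S: "subspace S"
    and slice: "\<phi> ` (M \<inter> U) = S \<inter> V" and q: "q \<in> M \<inter> U"
  shows "tangent_space M q = frechet_derivative \<psi> (at (\<phi> q) within V) ` S"
proof (intro equalityI subsetI)
  have UV: "open U" "open V" and smooth: "smooth_on U \<phi>" "smooth_on V \<psi>"
    using diffeo by (auto simp: diffeomorphism_def)
  note inv = diffeomorphism_inverse[OF diffeo]
  have \<phi>q: "\<phi> q \<in> S" "\<phi> q \<in> V"
    using slice q by auto
  let ?D = "frechet_derivative \<psi> (at (\<phi> q) within V)"
  have D: "(\<psi> has_derivative ?D) (at (\<phi> q) within V)"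
    using smooth_on_has_derivative smooth(2) \<phi>q(2) .
  {
    fix v assume "v \<in> ?D ` S"
    then obtain s where s: "s \<in> S" "v = ?D s" by blast
    define L where "L = (\<lambda>t::real. \<phi> q + t *\<^sub>R s)"
    have "open (L -` V)"
      unfolding L_def by (intro continuous_open_vimage UV continuous_intros)
    moreover have "0 \<in> L -` V"
      using \<phi>q by (simp add: L_def)
    ultimately obtain \<epsilon> where \<epsilon>: "\<epsilon> > 0" "ball 0 \<epsilon> \<subseteq> L -` V"
      by (meson openE)
    then have LV: "L t \<in> V" if "t \<in> {-\<epsilon><..<\<epsilon>}" for t
      using that by (auto simp: subset_iff dist_real_def)
    have "smooth_on {-\<epsilon><..<\<epsilon>} (\<lambda>t. \<psi> (L t))"
      using smooth(2) LV unfolding smooth_on_def L_def by (auto intro!: Ck_on_affine_line)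
    moreover have "\<psi> (L t) \<in> M" if t: "t \<in> {-\<epsilon><..<\<epsilon>}" for t
    proof -
      have "L t \<in> S \<inter> V"
        using LV[OF t] s \<phi>q S by (simp add: L_def subspace_add subspace_scale)
      then obtain x where "x \<in> M \<inter> U" "L t = \<phi> x"
        using slice by blast
      then show ?thesis using inv by simp
    qed
    moreover have "((\<lambda>t. \<psi> (L t)) has_vector_derivative v) (at 0)"
    proof -
      have "(L has_vector_derivative s) (at 0)"
        unfolding L_def by (auto intro!: derivative_eq_intros)
      moreover have "(\<psi> has_derivative ?D) (at (L 0))"
        using D \<phi>q UV by (simp add: L_def at_within_open_NO_MATCH)
      ultimately show ?thesis
        using vector_derivative_diff_chain_within[of L s 0 UNIV \<psi> ?D]
        by (simp add: comp_def s(2) has_derivative_at_withinI)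
    qed
    moreover have "\<psi> (L 0) = q"
      using inv(2)[of q] q by (simp add: L_def)
    ultimately show "v \<in> tangent_space M q"
      unfolding tangent_space_def mem_Collect_eq using \<epsilon>(1)
      by (intro exI[of _ \<epsilon>] exI[of _ "\<lambda>t. \<psi> (L t)"]) auto
  }
  {
    fix v assume "v \<in> tangent_space M q"
    then obtain \<epsilon> and \<gamma> :: "real \<Rightarrow> 'a" where \<gamma>: "\<epsilon> > 0" "\<gamma> ` {-\<epsilon><..<\<epsilon>} \<subseteq> M" "\<gamma> 0 = q"
        "(\<gamma> has_vector_derivative v) (at 0)"
      unfolding tangent_space_def by blast
    let ?E = "frechet_derivative \<phi> (at q within U)"
    have "(\<phi> has_derivative ?E) (at q)"
      using smooth_on_has_derivative[OF smooth(1), of q] q UV by (simp add: at_within_open_NO_MATCH)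
    then have deriv: "((\<lambda>t. \<phi> (\<gamma> t)) has_vector_derivative ?E v) (at 0)"
      using vector_derivative_diff_chain_within[OF \<gamma>(4), of \<phi> ?E] \<gamma>(3)
      by (simp add: comp_def has_derivative_at_withinI)
    \<comment> \<open>The component \<open>z\<close> of the velocity normal to the slice is the functional to test with.\<close>
    obtain u z where uz: "u \<in> span S" "\<And>w. w \<in> span S \<Longrightarrow> orthogonal z w" "?E v = u + z"
      using orthogonal_subspace_decomp_exists[of S "?E v"] by metis
    have "isCont \<gamma> 0"
      using \<gamma>(4) has_derivative_continuous unfolding has_vector_derivative_def by blast
    then have "(\<gamma> \<longlongrightarrow> q) (nhds 0)"
      using tendsto_at_iff_tendsto_nhds[of \<gamma> 0] \<gamma>(3) by (simp add: isCont_def)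
    then have "\<forall>\<^sub>F t in nhds 0. \<gamma> t \<in> U"
      using topological_tendstoD UV(1) q by blast
    moreover have "\<forall>\<^sub>F t in nhds 0. t \<in> {-\<epsilon><..<\<epsilon>}"
      using \<gamma>(1) by (intro eventually_nhds_in_open) auto
    ultimately have zero: "\<forall>\<^sub>F t in nhds 0. \<phi> (\<gamma> t) \<bullet> z = 0"
    proof eventually_elim
      case (elim t)
      then have "\<phi> (\<gamma> t) \<in> \<phi> ` (M \<inter> U)"
        using \<gamma>(2) by force
      then have "\<phi> (\<gamma> t) \<in> S"
        by (simp add: slice)
      then show ?case
        using uz(2)[OF span_base] by (metis inner_commute orthogonal_def)
    qed
    have "((\<lambda>t. \<phi> (\<gamma> t) \<bullet> z) has_real_derivative ?E v \<bullet> z) (at 0)"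
      unfolding has_real_derivative_iff_has_vector_derivative
      by (rule bounded_linear.has_vector_derivative[OF bounded_linear_inner_left deriv])
    then have "?E v \<bullet> z = 0"
      using DERIV_cong_ev[OF refl zero refl] DERIV_unique DERIV_const by blast
    then have "z = 0"
      using uz(2)[OF uz(1)] by (simp add: uz(3) orthogonal_def inner_add_right inner_commute)
    then have "?E v \<in> S"
      using uz(1,3) S by (simp add: span_eq_iff[THEN iffD2])
    then show "v \<in> ?D ` S"
      using diffeomorphism_derivative_inverse[OF diffeo, of q v] q by force
  }
qed

section \<open>Tangential parts on a submanifold\<close>

lemma submanifold_subspace_tangent_space:
  assumes "submanifold M" "q \<in> M"
  shows "subspace (tangent_space M q)"
proof -
  obtain U V \<phi> \<psi> S where c: "diffeomorphism U V \<phi> \<psi>" "q \<in> U" "subspace S" "\<phi> ` (M \<inter> U) = S \<inter> V"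
    using assms unfolding submanifold_def by metis
  moreover have "linear (frechet_derivative \<psi> (at (\<phi> q) within V))"
    using c diffeomorphism_inverse(1)[OF c(1,2)]
    by (auto simp: diffeomorphism_def intro: smooth_on_has_derivative has_derivative_linear)
  ultimately show ?thesis
    using assms(2) tangent_space_slice_chart by (metis IntI linear_subspace_image)
qed

lemma tangent_part_unique:
  assumes W: "subspace (tangent_space M q)"
    and "u \<in> tangent_space M q" "\<And>y. y \<in> tangent_space M q \<Longrightarrow> (v - u) \<bullet> y = 0"
  shows "tangent_part M q v = u"
  unfolding tangent_part_def
proof (rule the_equality)
  show "u \<in> tangent_space M q \<and> v - u \<in> orthogonal_comp (tangent_space M q)"
    using assms by (auto simp: orthogonal_comp_def orthogonal_def inner_commute)
next
  fix w assume w: "w \<in> tangent_space M q \<and> v - w \<in> orthogonal_comp (tangent_space M q)"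
  then have "u - w \<in> tangent_space M q"
    using assms by (simp add: subspace_diff)
  then have "(v - u) \<bullet> (u - w) = 0" "(v - w) \<bullet> (u - w) = 0"
    using w assms(3) by (auto simp: orthogonal_comp_def orthogonal_def inner_commute)
  then have "(u - w) \<bullet> (u - w) = 0"
    by (simp add: inner_diff_left)
  then show "w = u" by simp
qed

lemma
  assumes W: "subspace (tangent_space M q)"
  shows tangent_part_in: "tangent_part M q v \<in> tangent_space M q"
    and inner_tangent_part: "y \<in> tangent_space M q \<Longrightarrow> tangent_part M q v \<bullet> y = v \<bullet> y"
proof -
  obtain u z where uz: "u \<in> span (tangent_space M q)"
      "\<And>w. w \<in> span (tangent_space M q) \<Longrightarrow> orthogonal z w" "v = u + z"
    using orthogonal_subspace_decomp_exists[of "tangent_space M q" v] by metis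
  then have u: "u \<in> tangent_space M q" "\<And>y. y \<in> tangent_space M q \<Longrightarrow> (v - u) \<bullet> y = 0"
    using W by (auto simp: span_eq_iff[THEN iffD2] orthogonal_def)
  then have "tangent_part M q v = u"
    using tangent_part_unique[OF W] by blast
  then show "tangent_part M q v \<in> tangent_space M q"
    and "y \<in> tangent_space M q \<Longrightarrow> tangent_part M q v \<bullet> y = v \<bullet> y"
    using u by (auto simp: inner_diff_left)
qed

text \<open>
  One Gram-Schmidt step per field: the new field minus its projection onto the span of the previous
  ones never vanishes, by independence, so the quotient in the projection onto it is
  differentiable. The statement is about an arbitrary field \<open>f\<close> because the step also
  projects the new field.
\<close>

lemma differentiable_projection_onto_span:
  fixes X :: "'i \<Rightarrow> 'b::real_normed_vector \<Rightarrow> 'a::euclidean_space"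
  assumes "finite J" and q: "q \<in> W"
    and "\<And>i. i \<in> J \<Longrightarrow> X i differentiable (at q within W)"
    and "\<And>p i. p \<in> W \<Longrightarrow> i \<in> J \<Longrightarrow> X i p \<notin> span ((\<lambda>k. X k p) ` (J - {i}))"
    and "f differentiable (at q within W)"
  shows "\<exists>g. g differentiable (at q within W) \<and>
    (\<forall>p\<in>W. g p \<in> span ((\<lambda>i. X i p) ` J) \<and> (\<forall>y\<in>span ((\<lambda>i. X i p) ` J). (f p - g p) \<bullet> y = 0))"
  using assms(1,3-)
proof (induction J arbitrary: f rule: finite_induct)
  case empty
  then show ?case by (intro exI[of _ "\<lambda>_. 0"]) auto
next
  case (insert b J)
  have indep: "X i p \<notin> span ((\<lambda>k. X k p) ` (J - {i}))" if "p \<in> W" "i \<in> J" for p i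
    using insert.prems(2)[of p i] that span_mono[of "(\<lambda>k. X k p) ` (J - {i})"]
    by (meson Diff_mono image_mono insertCI subset_iff subset_insertI order_refl)
  define P where "P = (\<lambda>f g. g differentiable (at q within W) \<and>
    (\<forall>p\<in>W. g p \<in> span ((\<lambda>i. X i p) ` J) \<and> (\<forall>y\<in>span ((\<lambda>i. X i p) ` J). (f p - g p) \<bullet> y = 0)))"
  have "\<exists>g. P f g" if "f differentiable (at q within W)" for f
    unfolding P_def using insert.prems indep that by (intro insert.IH) auto
  then obtain g h where g: "P f g" and h: "P (X b) h"
    using insert.prems by (metis insertI1)
  define w where "w = (\<lambda>p. X b p - h p)"
  have w_diff: "w differentiable (at q within W)"
    using h insert.prems(1) unfolding w_def P_def by (intro differentiable_diff) auto
  have w0: "w p \<noteq> 0" if "p \<in> W" for p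
  proof
    assume "w p = 0"
    then have "X b p \<in> span ((\<lambda>i. X i p) ` J)"
      using h that by (auto simp: w_def P_def)
    then show False
      using insert.prems(2)[of p b] that insert.hyps by simp
  qed
  define k where "k = (\<lambda>p. g p + ((f p \<bullet> w p) / (w p \<bullet> w p)) *\<^sub>R w p)"
  have "k differentiable (at q within W)"
    unfolding k_def using g w_diff w0[OF q] insert.prems(3)
    by (intro differentiable_add differentiable_scaleR differentiable_divide differentiable_inner)
       (auto simp: P_def)
  moreover have "k p \<in> span ((\<lambda>i. X i p) ` insert b J)"
    and "\<forall>y\<in>span ((\<lambda>i. X i p) ` insert b J). (f p - k p) \<bullet> y = 0" if p: "p \<in> W" for p
  proof -
    let ?S = "span ((\<lambda>i. X i p) ` J)" and ?S' = "span ((\<lambda>i. X i p) ` insert b J)"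
    have gh: "g p \<in> ?S" "h p \<in> ?S" and g_orth: "\<And>y. y \<in> ?S \<Longrightarrow> (f p - g p) \<bullet> y = 0"
      and w_orth: "\<And>y. y \<in> ?S \<Longrightarrow> w p \<bullet> y = 0"
      using g h p by (auto simp: P_def w_def)
    have "?S \<subseteq> ?S'"
      by (intro span_mono) auto
    moreover have "X b p \<in> ?S'"
      by (intro span_base) simp
    ultimately show "k p \<in> ?S'"
      using gh by (auto simp: k_def w_def intro!: span_add span_scale span_diff)
    have orth: "(f p - k p) \<bullet> y = 0" if "y \<in> ?S" for y
      using g_orth[OF that] w_orth[OF that] by (simp add: k_def algebra_simps)
    have "(f p - k p) \<bullet> w p = 0"
      using w0[OF p] w_orth[OF gh(1)] by (simp add: k_def algebra_simps inner_commute)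
    then have "(f p - k p) \<bullet> X b p = 0"
      using orth[OF gh(2)] by (simp add: w_def inner_diff_right)
    then have "\<forall>y \<in> (\<lambda>i. X i p) ` insert b J. orthogonal (f p - k p) y"
      using orth by (auto simp: orthogonal_def intro: span_base)
    then show "\<forall>y\<in>?S'. (f p - k p) \<bullet> y = 0"
      using orthogonal_to_span by (metis orthogonal_def)
  qed
  ultimately show ?case by blast
qed

lemma differentiable_tangent_part:
  fixes M :: "'a::euclidean_space set"
  assumes M: "submanifold M" and q: "q \<in> M"
  shows "(\<lambda>p. tangent_part M p v) differentiable (at q within M)"
proof -
  obtain U V \<phi> \<psi> S where diffeo: "diffeomorphism U V \<phi> \<psi>" and qU: "q \<in> U"
    and S: "subspace S" and slice: "\<phi> ` (M \<inter> U) = S \<inter> V"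
    using M q unfolding submanifold_def by metis
  have "open U" and smooth: "smooth_on U \<phi>" "smooth_on V \<psi>"
    using diffeo by (auto simp: diffeomorphism_def)
  note inv = diffeomorphism_inverse[OF diffeo]
  obtain B where B: "B \<subseteq> S" "independent B" "S \<subseteq> span B"
    using basis_exists[of S] by metis
  have span_B: "span B = S"
    using B S by (metis span_minimal subset_antisym)
  define X where "X = (\<lambda>b p. frechet_derivative \<psi> (at (\<phi> p) within V) b)"
  have lin: "linear (\<lambda>b. X b p)" if "p \<in> M \<inter> U" for p
    using that inv smooth unfolding X_def
    by (auto intro: smooth_on_has_derivative has_derivative_linear)
  have inj: "inj (\<lambda>b. X b p)" if "p \<in> M \<inter> U" for p
    using diffeomorphism_derivative_inverse[OF diffeomorphism_sym[OF diffeo], of "\<phi> p"] that inv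
    unfolding X_def by (intro injI) (metis IntD2)
  have span: "span ((\<lambda>b. X b p) ` B) = tangent_space M p" if "p \<in> M \<inter> U" for p
    using tangent_space_slice_chart[OF diffeo S slice that] linear_span_image[OF lin[OF that], of B]
    by (simp add: span_B X_def)
  have "X b differentiable (at q within M \<inter> U)" for b
  proof -
    have "(\<lambda>x. frechet_derivative \<psi> (at x within V) b) differentiable (at (\<phi> q) within V)"
      using smooth_on_differentiable_derivative[OF smooth(2)] inv(1)[OF qU]
      by (simp add: differentiable_on_def)
    moreover have "\<phi> ` (M \<inter> U) \<subseteq> V"
      using slice by blast
    ultimately have "(\<lambda>x. frechet_derivative \<psi> (at x within V) b) differentiable
        (at (\<phi> q) within \<phi> ` (M \<inter> U))"
      by (rule differentiable_within_subset)
    moreover have "\<phi> differentiable (at q within M \<inter> U)"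
      using smooth_on_has_derivative[OF smooth(1) qU]
      by (meson differentiableI differentiable_within_subset inf_le2)
    ultimately show ?thesis
      using differentiable_chain_within[of \<phi> q "M \<inter> U"] by (simp add: X_def comp_def)
  qed
  moreover have "X b p \<notin> span ((\<lambda>k. X k p) ` (B - {b}))" if "p \<in> M \<inter> U" "b \<in> B" for p b
  proof -
    have "b \<notin> span (B - {b})"
      using B(2) that(2) by (auto simp: dependent_def)
    then have "X b p \<notin> (\<lambda>k. X k p) ` span (B - {b})"
      using inj_image_mem_iff[OF inj[OF that(1)]] by blast
    then show ?thesis
      by (simp add: linear_span_image[OF lin[OF that(1)]])
  qed
  ultimately have "\<exists>g. g differentiable (at q within M \<inter> U) \<and>
      (\<forall>p\<in>M \<inter> U. g p \<in> span ((\<lambda>b. X b p) ` B) \<and> (\<forall>y\<in>span ((\<lambda>b. X b p) ` B). (v - g p) \<bullet> y = 0))"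
    using q qU by (intro differentiable_projection_onto_span independent_imp_finite[OF B(2)]) auto
  then obtain g where g: "g differentiable (at q within M \<inter> U)"
    and proj: "\<And>p. p \<in> M \<inter> U \<Longrightarrow> g p \<in> tangent_space M p \<and> (\<forall>y\<in>tangent_space M p. (v - g p) \<bullet> y = 0)"
    using span by auto
  have "g p = tangent_part M p v" if "p \<in> M \<inter> U" for p
    using proj[OF that] that submanifold_subspace_tangent_space[OF M] tangent_part_unique
    by (metis IntD1)
  then have "(\<lambda>p. tangent_part M p v) differentiable (at q within M \<inter> U)"
    using g q qU has_derivative_transform[of q "M \<inter> U" "\<lambda>p. tangent_part M p v" g]
    unfolding differentiable_def by auto
  moreover have "at q within M \<inter> U = at q within M"
    using \<open>open U\<close> qU by (intro at_within_nhd[of _ U]) auto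
  ultimately show ?thesis by simp
qed

section \<open>Helices\<close>

text \<open>
  The projection \<open>P\<close> of \<open>d\<close> satisfies \<open>d \<bullet> P = P \<bullet> P\<close>, so the cosine of its angle with \<open>d\<close> is
  the norm of \<open>P\<close>. An angle below \<open>pi/2\<close> excludes \<open>P = 0\<close>, where the angle is \<open>pi/2\<close> by convention.
\<close>

lemma helix_decomposition:
  fixes M :: "'a::euclidean_space set"
  assumes "helix M d"
  obtains \<theta> where "cos \<theta> > 0" "sin \<theta> > 0"
    and "\<And>q. q \<in> M \<Longrightarrow> tangent_part M q d = cos \<theta> *\<^sub>R unit_tangent_component M d q"
    and "\<And>q. q \<in> M \<Longrightarrow> normal_part M q d = sin \<theta> *\<^sub>R unit_normal_component M d q"
    and "\<And>q. q \<in> M \<Longrightarrow> norm (unit_tangent_component M d q) = 1"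
    and "\<And>q. q \<in> M \<Longrightarrow> norm (unit_normal_component M d q) = 1"
proof -
  obtain \<theta> where M: "submanifold M" and d: "norm d = 1" and \<theta>: "0 < \<theta>" "\<theta> < pi/2"
    and angle: "\<And>q. q \<in> M \<Longrightarrow> angle_tangent_space M q d = \<theta>"
    using assms unfolding helix_def by blast
  have pos: "cos \<theta> > 0" "sin \<theta> > 0"
    using \<theta> by (auto intro: cos_gt_zero sin_gt_zero)
  have norms: "norm (tangent_part M q d) = cos \<theta>" "norm (normal_part M q d) = sin \<theta>" if q: "q \<in> M" for q
  proof -
    define P where "P = tangent_part M q d"
    note W = submanifold_subspace_tangent_space[OF M q]
    have dP: "d \<bullet> P = P \<bullet> P"
      using inner_tangent_part[OF W tangent_part_in[OF W], of d d] by (simp add: P_def)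
    have arc: "arccos (d \<bullet> P / norm P) = \<theta>"
      using angle[OF q] d by (simp add: angle_tangent_space_def angle_def P_def)
    then have "P \<noteq> 0"
      using \<theta> by auto
    then have quot: "d \<bullet> P / norm P = norm P"
      by (simp add: dP dot_square_norm power2_eq_square)
    have "norm P \<le> 1"
      using norm_cauchy_schwarz[of d P] d \<open>P \<noteq> 0\<close> by (simp add: dP dot_square_norm power2_eq_square)
    then have P: "norm P = cos \<theta>"
      using arc quot by (metis cos_arccos norm_ge_zero neg_le_0_iff_le order_trans zero_le_one)
    then show "norm (tangent_part M q d) = cos \<theta>"
      by (simp add: P_def)
    have "(norm (d - P))\<^sup>2 = (norm d)\<^sup>2 - (norm P)\<^sup>2"
      by (simp add: power2_norm_eq_inner inner_diff dP inner_commute[of P d])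
    then have "(norm (d - P))\<^sup>2 = (sin \<theta>)\<^sup>2"
      by (simp add: d P sin_squared_eq)
    then show "norm (normal_part M q d) = sin \<theta>"
      using pos by (simp add: normal_part_def P_def)
  qed
  show ?thesis
  proof (rule that[OF pos])
    fix q assume q: "q \<in> M"
    note n = norms[OF q]
    show "tangent_part M q d = cos \<theta> *\<^sub>R unit_tangent_component M d q"
      "normal_part M q d = sin \<theta> *\<^sub>R unit_normal_component M d q"
      using pos n by (auto simp: unit_tangent_component_def unit_normal_component_def sgn_div_norm)
    have "tangent_part M q d \<noteq> 0" "normal_part M q d \<noteq> 0"
      using pos n by auto
    then show "norm (unit_tangent_component M d q) = 1" "norm (unit_normal_component M d q) = 1"
      by (simp_all add: unit_tangent_component_def unit_normal_component_def norm_sgn)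
  qed
qed

text \<open>
  Along a curve with velocity \<open>X\<close>, differentiating the constants \<open>\<xi> \<bullet> d = sin \<theta>\<close> and \<open>\<xi> \<bullet> \<xi> = 1\<close>
  makes \<open>D\<^sub>X \<xi>\<close> orthogonal to \<open>d\<close> and \<open>\<xi>\<close>, and \<open>T\<close> is a combination of these two.
\<close>

lemma helix_shape_operator_orthogonal:
  fixes M :: "'a::euclidean_space set"
  assumes helix: "helix M d" and t: "t \<in> I" "at t within I \<noteq> bot" and sub: "\<alpha> ` I \<subseteq> M"
    and \<alpha>: "(\<alpha> has_vector_derivative X) (at t within I)"
  shows "shape_operator M (unit_normal_component M d) (\<alpha> t) X \<bullet> unit_tangent_component M d (\<alpha> t) = 0"
proof -
  define q where "q = \<alpha> t"
  define T where "T = unit_tangent_component M d"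
  define \<xi> where "\<xi> = unit_normal_component M d"
  have q: "q \<in> M"
    using t sub by (auto simp: q_def)
  have M: "submanifold M"
    using helix by (simp add: helix_def)
  obtain \<theta> where pos: "cos \<theta> > 0" "sin \<theta> > 0"
    and tangent: "\<And>p. p \<in> M \<Longrightarrow> tangent_part M p d = cos \<theta> *\<^sub>R T p"
    and normal: "\<And>p. p \<in> M \<Longrightarrow> normal_part M p d = sin \<theta> *\<^sub>R \<xi> p"
    and unit: "\<And>p. p \<in> M \<Longrightarrow> norm (\<xi> p) = 1"
    using helix_decomposition[OF helix] unfolding T_def \<xi>_def by metis
  have decomp: "d = cos \<theta> *\<^sub>R T p + sin \<theta> *\<^sub>R \<xi> p" if "p \<in> M" for p
    using tangent[OF that] normal[OF that]
    by (metis add.commute diff_add_cancel normal_part_def)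
  note W = submanifold_subspace_tangent_space[OF M]
  have T_tangent: "T p \<in> tangent_space M p" if "p \<in> M" for p
    using subspace_scale[OF W[OF that] tangent_part_in[OF W[OF that], of d], of "1 / cos \<theta>"]
      tangent[OF that] pos by simp
  have T\<xi>: "T p \<bullet> \<xi> p = 0" if p: "p \<in> M" for p
  proof -
    have "normal_part M p d \<bullet> T p = 0"
      using inner_tangent_part[OF W[OF p] T_tangent[OF p], of d]
      by (simp add: normal_part_def inner_diff_left)
    then show ?thesis
      using normal[OF p] pos by (simp add: inner_commute)
  qed
  define D where "D = covariant_derivative M \<xi> q X"
  \<comment> \<open>This makes the chosen derivative in the shape operator an actual derivative of \<open>\<xi>\<close>, so that its
    value at \<open>X\<close> can be computed along the curve.\<close>
  have "\<xi> differentiable (at q within M)"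
  proof -
    have "(\<lambda>p. (1 / sin \<theta>) *\<^sub>R (d - tangent_part M p d)) differentiable (at q within M)"
      by (intro differentiable_scaleR differentiable_diff differentiable_const
          differentiable_tangent_part M q)
    moreover have "\<xi> p = (1 / sin \<theta>) *\<^sub>R (d - tangent_part M p d)" if "p \<in> M" for p
      using normal[OF that] pos by (simp add: normal_part_def)
    ultimately show ?thesis
      using q unfolding differentiable_def by (metis (lifting) has_derivative_transform)
  qed
  then have "(\<xi> has_derivative frechet_derivative \<xi> (at q within M)) (at q within \<alpha> ` I)"
    using sub frechet_derivative_works has_derivative_subset by blast
  then have curve: "((\<lambda>s. \<xi> (\<alpha> s)) has_vector_derivative D) (at t within I)"
    using vector_derivative_diff_chain_within[OF \<alpha>]
    by (simp add: D_def covariant_derivative_def q_def comp_def)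
  have const: "c' = 0" if "(f has_vector_derivative c') (at t within I)" "\<And>s. s \<in> I \<Longrightarrow> f s = c"
    for f :: "real \<Rightarrow> real" and c c'
    using vector_derivative_unique_within[OF t(2)] that t(1)
    by (metis has_vector_derivative_const has_vector_derivative_transform)
  have "D \<bullet> d = 0"
  proof (rule const)
    show "((\<lambda>s. \<xi> (\<alpha> s) \<bullet> d) has_vector_derivative D \<bullet> d) (at t within I)"
      by (rule bounded_linear.has_vector_derivative[OF bounded_linear_inner_left curve])
    show "\<xi> (\<alpha> s) \<bullet> d = sin \<theta>" if "s \<in> I" for s
    proof -
      have p: "\<alpha> s \<in> M"
        using that sub by blast
      show ?thesis
        using decomp[OF p] T\<xi>[OF p] unit[OF p]
        by (metis add.left_neutral dot_square_norm inner_add_right inner_commute inner_scaleR_right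
            mult.right_neutral mult_zero_right one_power2)
    qed
  qed
  moreover have "D \<bullet> \<xi> q = 0"
  proof -
    have "2 * (D \<bullet> \<xi> q) = 0"
    proof (rule const)
      show "((\<lambda>s. \<xi> (\<alpha> s) \<bullet> \<xi> (\<alpha> s)) has_vector_derivative 2 * (D \<bullet> \<xi> q)) (at t within I)"
        using has_derivative_inner[OF curve[unfolded has_vector_derivative_def]
            curve[unfolded has_vector_derivative_def]]
        by (simp add: has_vector_derivative_def q_def inner_commute algebra_simps)
      show "\<xi> (\<alpha> s) \<bullet> \<xi> (\<alpha> s) = 1" if "s \<in> I" for s
        using unit[of "\<alpha> s"] that sub by (auto simp: dot_square_norm)
    qed
    then show ?thesis by simp
  qed
  ultimately have "D \<bullet> T q = 0"
    using decomp[OF q] pos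
    by (metis add.right_neutral inner_add_right inner_scaleR_right less_irrefl mult_eq_0_iff mult_zero_right)
  then show ?thesis
    using inner_tangent_part[OF W[OF q] T_tangent[OF q], of "- D"]
    by (simp add: shape_operator_def D_def T_def \<xi>_def q_def)
qed

theorem theorem3p5:
  fixes M :: "(real ^ 'n) set" and d :: "nat \<Rightarrow> real ^ 'n" and r j :: nat
    and I :: "real set" and \<alpha> :: "real \<Rightarrow> real ^ 'n"
  assumes "weak_helix r M d"
    and "j \<in> {1..r}"
    and "integral_curve M (unit_tangent_component M (d j)) I \<alpha>"
  shows "asymptotic M (unit_normal_component M (d j)) I \<alpha> \<and>
    (\<forall>t\<in>I. shape_operator M (unit_normal_component M (d j)) (\<alpha> t)
              (unit_tangent_component M (d j) (\<alpha> t)) \<bullet>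
            unit_tangent_component M (d j) (\<alpha> t) = 0)"
proof -
  have helix: "helix M (d j)"
    using assms by (simp add: weak_helix_def)
  have curve: "curve_in M I \<alpha>"
    and deriv: "\<And>t. t \<in> I \<Longrightarrow>
      (\<alpha> has_vector_derivative unit_tangent_component M (d j) (\<alpha> t)) (at t within I)"
    using assms(3) by (auto simp: integral_curve_def)
  have I: "is_interval I" "interior I \<noteq> {}" and sub: "\<alpha> ` I \<subseteq> M"
    using curve by (auto simp: curve_in_def)
  have limpt: "at t within I \<noteq> bot" if "t \<in> I" for t
  proof -
    have "\<not> (\<exists>a. I = {a})"
      using I(2) by auto
    then have "t islimpt I"
      using connected_imp_perfect[of I t] is_interval_connected[OF I(1)] that by blast
    then show ?thesis
      by (simp add: trivial_limit_within)
  qed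
  have velocity: "velocity I \<alpha> t = unit_tangent_component M (d j) (\<alpha> t)" if "t \<in> I" for t
    unfolding velocity_def using vector_derivative_within[OF limpt deriv] that by blast
  have "norm (unit_tangent_component M (d j) (\<alpha> t)) = 1" if "t \<in> I" for t
    using helix_decomposition[OF helix] that sub by (metis image_subset_iff)
  moreover have "shape_operator M (unit_normal_component M (d j)) (\<alpha> t)
      (unit_tangent_component M (d j) (\<alpha> t)) \<bullet> unit_tangent_component M (d j) (\<alpha> t) = 0"
    if "t \<in> I" for t
    using helix_shape_operator_orthogonal[OF helix that limpt[OF that] sub deriv[OF that]] .
  ultimately show ?thesis
    using curve velocity by (simp add: asymptotic_def unit_speed_curve_in_def)
qed

end
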